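(* For any stochastic graph $G=(U,V,E)$ with downward-closed probing constraints $(\mathcal{C}_v)_{v\in V}$, $\mathrm{OPT}_{\mathrm{rel}}(G)=\mathrm{LPOPT}(G)$.
   Context: A stochastic graph is a finite bipartite graph $G=(U,V,E)$, $E=U\times V$, nonnegative weights $(w_e)$, probabilities $(p_e)\subseteq[0,1]$; each edge $e$ has an independent hidden state $\mathrm{st}(e)\sim\mathrm{Ber}(p_e)$ revealed on probing. $S^{( * )}$: tuples of distinct elements of $S$ incl. the empty string $\lambda$; $\partial(v)$: edges at $v$; $\mathcal{C}_v\subseteq\partial(v)^{( * )}$ downward-closed (closed under substrings and permutations). A relaxed probing algorithm knows $G$ and adaptively (possibly randomly) probes edges in any order so that for each $v\in V$ the probed edges of $\partial(v)$, in order, form a string in $\mathcal{C}_v$; in the probe-commit model (on revealing a probed edge active it irrevocably decides whether to include it before further probes; only probed active edges can be included). Its output must satisfy: each $v\in V$ in at most one output edge, and for each $u\in U$ the expected number of output edges at $u$ is at most $1$. $\mathrm{OPT}_{\mathrm{rel}}(G)$ is the supremum over relaxed probing algorithms of the expected total weight of the output. For $\bm e=(e_1,\dots,e_k)$: $g(\bm e)=\prod_j(1-p_{e_j})$, $g(\lambda)=1$, $\bm e_{<e_j}=(e_1,\dots,e_{j-1})$, $\mathrm{val}(\bm e)=\sum_jp_{e_j}w_{e_j}g(\bm e_{<e_j})$. $\mathrm{LPOPT}(G)$ is the optimum of LP-config: variables $x_v(\bm e)\ge0$; maximize $\sum_v\sum_{\bm e\in\mathcal{C}_v}\mathrm{val}(\bm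 e)x_v(\bm e)$ s.t. $\sum_v\sum_{\bm e\in\mathcal{C}_v:(u,v)\in\bm e}p_{u,v}g(\bm e_{<(u,v)})x_v(\bm e)\le1$ ($u\in U$), $\sum_{\bm e\in\mathcal{C}_v}x_v(\bm e)=1$ ($v\in V$). *)

theory Defs
  imports "HOL-Probability.Probability" "HOL-Library.Sublist"
begin

definition stochastic_graph ::
  "'u set \<Rightarrow> 'v set \<Rightarrow> ('u \<times> 'v \<Rightarrow> real) \<Rightarrow> ('u \<times> 'v \<Rightarrow> real) \<Rightarrow> bool" where
  "stochastic_graph U V w p \<longleftrightarrow>
     finite U \<and> finite V \<and> (\<forall>e\<in>U \<times> V. 0 \<le> w e) \<and> (\<forall>e\<in>U \<times> V. p e \<in> {0..1})"

definition strings :: "'e set \<Rightarrow> 'e list set" where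
  "strings S = {es. distinct es \<and> set es \<subseteq> S}"

definition edges_at :: "'u set \<Rightarrow> 'v \<Rightarrow> ('u \<times> 'v) set" where
  "edges_at U v = U \<times> {v}"

(* Substrings are contiguous here.  In the presence of closure under permutations
   this is the same as closure under arbitrary subsequences. *)
definition downward_closed :: "'e list set \<Rightarrow> bool" where
  "downward_closed C \<longleftrightarrow>
     (\<forall>es\<in>C. \<forall>es'. sublist es' es \<longrightarrow> es' \<in> C) \<and>
     (\<forall>es\<in>C. \<forall>es'. mset es' = mset es \<longrightarrow> es' \<in> C)"

(* Deterministic adaptive strategies in the probe-commit model.
   Probe e b s t probes e; if e is active, it is irrevocably included in the output
   iff b holds and the strategy continues with s; if e is inactive, the strategy
   continues with t. *)
datatype 'e policy = Stop | Probe 'e bool "'e policy" "'e policy"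

primrec probed :: "'e policy \<Rightarrow> ('e \<Rightarrow> bool) \<Rightarrow> 'e list" where
  "probed Stop st = []"
| "probed (Probe e b s t) st = e # (if st e then probed s st else probed t st)"

primrec outcome :: "'e policy \<Rightarrow> ('e \<Rightarrow> bool) \<Rightarrow> 'e set" where
  "outcome Stop st = {}"
| "outcome (Probe e b s t) st =
     (if st e then (if b then {e} else {}) \<union> outcome s st else outcome t st)"

definition states :: "'u set \<Rightarrow> 'v set \<Rightarrow> ('u \<times> 'v \<Rightarrow> real) \<Rightarrow> ('u \<times> 'v \<Rightarrow> bool) pmf" where
  "states U V p = Pi_pmf (U \<times> V) False (\<lambda>e. bernoulli_pmf (p e))"

(* A randomized algorithm is a random choice of a deterministic strategy, drawn
   independently of the edge states.  Only finitely many strategies satisfy the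
   probing constraints, so discrete distributions cover all sources of randomness. *)
definition run ::
  "'u set \<Rightarrow> 'v set \<Rightarrow> ('u \<times> 'v \<Rightarrow> real) \<Rightarrow> ('u \<times> 'v) policy pmf \<Rightarrow>
     (('u \<times> 'v) policy \<times> ('u \<times> 'v \<Rightarrow> bool)) pmf" where
  "run U V p A = pair_pmf A (states U V p)"

definition respects_probing ::
  "'u set \<Rightarrow> 'v set \<Rightarrow> ('v \<Rightarrow> ('u \<times> 'v) list set) \<Rightarrow> ('u \<times> 'v) policy \<Rightarrow> bool" where
  "respects_probing U V C \<pi> \<longleftrightarrow>
     (\<forall>st. set (probed \<pi> st) \<subseteq> U \<times> V \<and>
           (\<forall>v\<in>V. filter (\<lambda>e. snd e = v) (probed \<pi> st) \<in> C v))"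

definition relaxed_probing_algorithm ::
  "'u set \<Rightarrow> 'v set \<Rightarrow> ('u \<times> 'v \<Rightarrow> real) \<Rightarrow> ('v \<Rightarrow> ('u \<times> 'v) list set) \<Rightarrow>
     ('u \<times> 'v) policy pmf \<Rightarrow> bool" where
  "relaxed_probing_algorithm U V p C A \<longleftrightarrow>
     (\<forall>\<pi>\<in>set_pmf A. respects_probing U V C \<pi>) \<and>
     (\<forall>\<pi>\<in>set_pmf A. \<forall>st. \<forall>v\<in>V. card {e \<in> outcome \<pi> st. snd e = v} \<le> 1) \<and>
     (\<forall>u\<in>U. measure_pmf.expectation (run U V p A)
               (\<lambda>(\<pi>, st). real (card {e \<in> outcome \<pi> st. fst e = u})) \<le> 1)"

definition expected_weight ::
  "'u set \<Rightarrow> 'v set \<Rightarrow> ('u \<times> 'v \<Rightarrow> real) \<Rightarrow> ('u \<times> 'v \<Rightarrow> real) \<Rightarrow>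
     ('u \<times> 'v) policy pmf \<Rightarrow> real" where
  "expected_weight U V w p A =
     measure_pmf.expectation (run U V p A) (\<lambda>(\<pi>, st). \<Sum>e\<in>outcome \<pi> st. w e)"

definition OPT_rel ::
  "'u set \<Rightarrow> 'v set \<Rightarrow> ('u \<times> 'v \<Rightarrow> real) \<Rightarrow> ('u \<times> 'v \<Rightarrow> real) \<Rightarrow>
     ('v \<Rightarrow> ('u \<times> 'v) list set) \<Rightarrow> ereal" where
  "OPT_rel U V w p C =
     (SUP A \<in> {A. relaxed_probing_algorithm U V p C A}. ereal (expected_weight U V w p A))"

definition g :: "('e \<Rightarrow> real) \<Rightarrow> 'e list \<Rightarrow> real" where
  "g p es = (\<Prod>e\<leftarrow>es. 1 - p e)"

definition before :: "'e list \<Rightarrow> 'e \<Rightarrow> 'e list" where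
  "before es e = takeWhile (\<lambda>e'. e' \<noteq> e) es"

definition val :: "('e \<Rightarrow> real) \<Rightarrow> ('e \<Rightarrow> real) \<Rightarrow> 'e list \<Rightarrow> real" where
  "val w p es = (\<Sum>e\<leftarrow>es. p e * w e * g p (before es e))"

definition LP_feasible ::
  "'u set \<Rightarrow> 'v set \<Rightarrow> ('u \<times> 'v \<Rightarrow> real) \<Rightarrow> ('v \<Rightarrow> ('u \<times> 'v) list set) \<Rightarrow>
     ('v \<Rightarrow> ('u \<times> 'v) list \<Rightarrow> real) \<Rightarrow> bool" where
  "LP_feasible U V p C x \<longleftrightarrow>
     (\<forall>v\<in>V. \<forall>es\<in>C v. 0 \<le> x v es) \<and>
     (\<forall>u\<in>U. (\<Sum>v\<in>V. \<Sum>es\<in>{es \<in> C v. (u, v) \<in> set es}.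
               p (u, v) * g p (before es (u, v)) * x v es) \<le> 1) \<and>
     (\<forall>v\<in>V. (\<Sum>es\<in>C v. x v es) = 1)"

definition LP_value ::
  "'v set \<Rightarrow> ('u \<times> 'v \<Rightarrow> real) \<Rightarrow> ('u \<times> 'v \<Rightarrow> real) \<Rightarrow> ('v \<Rightarrow> ('u \<times> 'v) list set) \<Rightarrow>
     ('v \<Rightarrow> ('u \<times> 'v) list \<Rightarrow> real) \<Rightarrow> real" where
  "LP_value V w p C x = (\<Sum>v\<in>V. \<Sum>es\<in>C v. val w p es * x v es)"

definition LPOPT ::
  "'u set \<Rightarrow> 'v set \<Rightarrow> ('u \<times> 'v \<Rightarrow> real) \<Rightarrow> ('u \<times> 'v \<Rightarrow> real) \<Rightarrow>
     ('v \<Rightarrow> ('u \<times> 'v) list set) \<Rightarrow> ereal" where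
  "LPOPT U V w p C = (SUP x \<in> {x. LP_feasible U V p C x}. ereal (LP_value V w p C x))"

end

theory Submission imports Defs begin

text \<open>Both optima depend only on the probability with which each edge is output, and the two models
  realise the same families of such probabilities. From an LP solution, draw a string at every
  \<open>v\<close> independently and probe along it until the first active edge, which is taken. Conversely, fix
  \<open>v\<close> and simulate by coin flips every probe of an algorithm except those it would commit to at
  \<open>v\<close>. After a success at \<open>v\<close> nothing more can be taken there, so following only the failure branches
  of the remaining probes yields a random string in \<open>C v\<close> with the same output probabilities.\<close>

section \<open>Probability that an edge is the first active one along a string\<close>

definition hit :: "('e \<Rightarrow> real) \<Rightarrow> 'e list \<Rightarrow> 'e \<Rightarrow> real" where
  "hit p es e = (if e \<in> set es then p e * g p (before es e) else 0)"

lemma hit_Nil [simp]: "hit p [] e = 0"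
  by (simp add: hit_def)

text \<open>Condition on the first edge \<open>d\<close>: either it is active and the search ends,
  or it fails and the search goes on in \<open>es\<close>. This recursion is the one that policies
  and the search by \<open>find\<close> are compared with below.\<close>

lemma hit_Cons: "hit p (d # es) e = (if d = e then p e else (1 - p d) * hit p es e)"
  by (auto simp: hit_def before_def g_def)

lemma val_eq_sum_hit:
  assumes "distinct es" "set es \<subseteq> S" "finite S"
  shows "val w p es = (\<Sum>e\<in>S. w e * hit p es e)"
proof -
  have "val w p es = (\<Sum>e\<in>set es. w e * hit p es e)"
    unfolding val_def sum_list_distinct_conv_sum_set[OF assms(1)]
    by (rule sum.cong) (auto simp: hit_def)
  also have "\<dots> = (\<Sum>e\<in>S. w e * hit p es e)"
    using assms by (intro sum.mono_neutral_left) (auto simp: hit_def)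
  finally show ?thesis .
qed

section \<open>Finiteness, closure and distinctness of strings\<close>

lemma finite_strings: "finite S \<Longrightarrow> finite (strings S)"
  unfolding strings_def using finite_subset_distinct[of S]
  by (simp add: conj_commute)

text \<open>Permute \<open>xs\<close> so that \<open>es\<close> comes first, followed by the
  remaining entries; then \<open>es\<close> is a contiguous piece. Strings extracted from a policy
  may skip probes, so they are subsequences that need not be contiguous.\<close>

lemma downward_closed_subseq:
  assumes "downward_closed C" "xs \<in> C" "subseq es xs"
  shows "es \<in> C"
proof -
  have "mset es \<subseteq># mset xs"
    using assms(3)
    by induction (auto intro: subset_mset.order_trans simp: subset_mset.add_increasing)
  moreover obtain rs where "mset xs - mset es = mset rs"
    by (metis ex_mset)
  ultimately have "mset (es @ rs) = mset xs"
    by (metis mset_append subset_mset.add_diff_inverse)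
  then have "es @ rs \<in> C"
    using assms(1,2) unfolding downward_closed_def by blast
  moreover have "sublist es (es @ rs)"
    by (simp add: sublist_append_leftI)
  ultimately show ?thesis
    using assms(1) unfolding downward_closed_def by blast
qed

text \<open>Equal entries lie in the same fibre. The probing constraints speak only of the fibres
  over the vertices of \<open>V\<close>, and this lifts distinctness to the whole run.\<close>

lemma distinct_if_distinct_fibres:
  assumes "\<And>y. distinct (filter (\<lambda>x. f x = y) xs)"
  shows "distinct xs"
  using assms
proof (induction xs)
  case (Cons a xs)
  have "distinct (filter (\<lambda>x. f x = y) xs)" for y
    using Cons.prems[of y] by (simp split: if_splits)
  moreover have "a \<notin> set xs"
    using Cons.prems[of "f a"] by simp
  ultimately show ?case
    using Cons.IH by simp
qed simp

section \<open>Mixtures of distributions and resampling of one edge state\<close>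

lemma measure_bind_pmf:
  "measure_pmf.prob (bind_pmf M N) X = measure_pmf.expectation M (\<lambda>x. measure_pmf.prob (N x) X)"
proof -
  have "integrable (measure_pmf M) (\<lambda>x. measure_pmf.prob (N x) X)"
    by (rule measure_pmf.integrable_const_bound[where B = 1]) auto
  then have "ennreal (measure_pmf.prob (bind_pmf M N) X) =
      ennreal (measure_pmf.expectation M (\<lambda>x. measure_pmf.prob (N x) X))"
    by (simp add: measure_pmf.emeasure_eq_measure[symmetric] nn_integral_eq_integral[symmetric])
  then show ?thesis
    by (simp add: integral_nonneg_AE)
qed

text \<open>\<open>f\<close> may be unbounded; the common finite support \<open>S\<close> turns its
  expectation into a finite sum, which can be exchanged with the expectation over
  \<open>M\<close>.\<close>

lemma expectation_bind_pmf_finite_support: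
  fixes f :: "'b \<Rightarrow> real"
  assumes "finite S" "\<And>x. x \<in> set_pmf M \<Longrightarrow> set_pmf (N x) \<subseteq> S"
  shows "measure_pmf.expectation (bind_pmf M N) f =
    measure_pmf.expectation M (\<lambda>x. measure_pmf.expectation (N x) f)"
proof -
  have int: "integrable (measure_pmf M) (\<lambda>x. f y * pmf (N x) y)" for y
    by (intro integrable_mult_right measure_pmf.integrable_const_bound[where B = 1])
       (auto simp: pmf_le_1)
  have "measure_pmf.expectation (bind_pmf M N) f = (\<Sum>y\<in>S. f y * pmf (bind_pmf M N) y)"
    using assms by (intro integral_measure_pmf_real) auto
  also have "\<dots> = (\<Sum>y\<in>S. measure_pmf.expectation M (\<lambda>x. f y * pmf (N x) y))"
    by (simp add: pmf_bind)
  also have "\<dots> = measure_pmf.expectation M (\<lambda>x. \<Sum>y\<in>S. f y * pmf (N x) y)"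
    using int by (intro Bochner_Integration.integral_sum[symmetric]) auto
  also have "\<dots> = measure_pmf.expectation M (\<lambda>x. measure_pmf.expectation (N x) f)"
    using assms
    by (intro integral_cong_AE)
       (auto simp: AE_measure_pmf_iff intro!: integral_measure_pmf_real[symmetric])
  finally show ?thesis .
qed

text \<open>Overwriting one coordinate of a product distribution by a fresh independent draw does
  not change its law. This replaces conditioning on the state of \<open>e\<close>.\<close>

lemma states_resample:
  assumes "finite U" "finite V" "e \<in> U \<times> V"
  shows "states U V p =
    bind_pmf (bernoulli_pmf (p e)) (\<lambda>b. map_pmf (\<lambda>st. st(e := b)) (states U V p))"
proof -
  define E where "E = U \<times> V - {e}"
  have E: "U \<times> V = insert e E" "finite E" "e \<notin> E"
    using assms by (auto simp: E_def)
  show ?thesis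
    unfolding states_def E(1)
    by (simp add: Pi_pmf_insert'[OF E(2,3)] map_bind_pmf bind_return_pmf map_pmf_def bind_assoc_pmf)
qed

lemma prob_states_resample:
  assumes "finite U" "finite V" "e \<in> U \<times> V" "0 \<le> p e" "p e \<le> 1"
  shows "measure_pmf.prob (states U V p) {st. Q st} =
    p e * measure_pmf.prob (states U V p) {st. Q (st(e := True))} +
    (1 - p e) * measure_pmf.prob (states U V p) {st. Q (st(e := False))}"
  by (subst states_resample[where e = e and p = p, OF assms(1-3)], subst measure_bind_pmf)
     (simp add: assms vimage_def mult.commute)

section \<open>Policies under a change of one edge state, and the strings they induce\<close>

lemma probed_mem_fun_upd: "e \<in> set (probed \<pi> (st(e := b))) \<longleftrightarrow> e \<in> set (probed \<pi> st)"
  by (induction \<pi>) auto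

lemma probed_fun_upd: "e \<notin> set (probed \<pi> st) \<Longrightarrow> probed \<pi> (st(e := b)) = probed \<pi> st"
  by (induction \<pi>) (auto split: if_splits)

lemma outcome_fun_upd: "e \<notin> set (probed \<pi> st) \<Longrightarrow> outcome \<pi> (st(e := b)) = outcome \<pi> st"
  by (induction \<pi>) (auto split: if_splits)

lemma outcome_subset_probed: "outcome \<pi> st \<subseteq> set (probed \<pi> st)"
  by (induction \<pi>) auto

text \<open>Setting the state of \<open>e\<close> steers the run into either branch, where
  distinctness excludes \<open>e\<close>. Whether a branch probes \<open>e\<close> does not depend
  on the state of \<open>e\<close>, so the conclusion passes to every \<open>st\<close>.\<close>

lemma not_probed_again:
  assumes "\<And>st. distinct (probed (Probe e b s t) st)"
  shows "e \<notin> set (probed s st)" "e \<notin> set (probed t st)"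
  using assms[of "st(e := True)"] assms[of "st(e := False)"] by (auto simp: probed_mem_fun_upd)

text \<open>Neither branch reads the state of \<open>e\<close> again, so both can be run on the
  unmodified \<open>st\<close>. Together with resampling, this makes the branches policies on the
  full product distribution, as inductions on policies need.\<close>

lemma Probe_branches:
  assumes "\<And>st. distinct (probed (Probe e b s t) st)"
  shows "probed (Probe e b s t) (st(e := True)) = e # probed s st"
    and "probed (Probe e b s t) (st(e := False)) = e # probed t st"
    and "outcome (Probe e b s t) (st(e := True)) = (if b then {e} else {}) \<union> outcome s st"
    and "outcome (Probe e b s t) (st(e := False)) = outcome t st"
  using not_probed_again[OF assms]
  by (simp_all add: probed_fun_upd outcome_fun_upd del: fun_upd_apply)
     (simp_all add: fun_upd_apply)

text \<open>No coin is flipped at a recorded edge: the failure branch is followed with certainty,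
  and the factor 1 - \<open>p e\<close> enters later through \<open>hit\<close>. Probes at
  \<open>v\<close> that would not be committed are simulated like probes elsewhere.\<close>

primrec string_at :: "('u \<times> 'v \<Rightarrow> real) \<Rightarrow> 'v \<Rightarrow> ('u \<times> 'v) policy \<Rightarrow> ('u \<times> 'v) list pmf" where
  "string_at p v Stop = return_pmf []"
| "string_at p v (Probe e b s t) =
     (if b \<and> snd e = v then map_pmf ((#) e) (string_at p v t)
      else bind_pmf (bernoulli_pmf (p e)) (\<lambda>a. if a then string_at p v s else string_at p v t))"

lemma finite_set_string_at: "finite (set_pmf (string_at p v \<pi>))"
  by (induction \<pi>) auto

text \<open>Choose states that agree with the simulated coins and make every recorded edge inactive;
  distinctness makes these choices consistent. The real run then takes the same branches, and its
  uncommitted probes at \<open>v\<close> are the gaps in the subsequence.\<close>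

lemma string_at_subseq_probed:
  assumes "\<And>st. distinct (probed \<pi> st)" "es \<in> set_pmf (string_at p v \<pi>)"
  shows "\<exists>st. subseq es (filter (\<lambda>e. snd e = v) (probed \<pi> st))"
  using assms
proof (induction \<pi> arbitrary: es)
  case Stop
  then show ?case by simp
next
  case (Probe e b s t)
  note br = Probe_branches[OF Probe.prems(1)]
  have dist: "distinct (probed s st)" "distinct (probed t st)" for st
    using Probe.prems(1)[of "st(e := True)"] Probe.prems(1)[of "st(e := False)"]
    unfolding br by auto
  show ?case
  proof (cases "b \<and> snd e = v")
    case True
    with Probe.prems(2) obtain ds where ds: "es = e # ds" "ds \<in> set_pmf (string_at p v t)"
      by auto
    obtain st where "subseq ds (filter (\<lambda>e. snd e = v) (probed t st))"
      using Probe.IH(2)[OF dist(2) ds(2)] by blast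
    then show ?thesis
      using True ds(1) by (intro exI[of _ "st(e := False)"]) (unfold br, simp)
  next
    case False
    with Probe.prems(2) have "es \<in> set_pmf (string_at p v s) \<or> es \<in> set_pmf (string_at p v t)"
      by (auto split: if_splits)
    then show ?thesis
    proof
      assume "es \<in> set_pmf (string_at p v s)"
      then obtain st where "subseq es (filter (\<lambda>e. snd e = v) (probed s st))"
        using Probe.IH(1)[OF dist(1)] by blast
      then show ?thesis
        by (intro exI[of _ "st(e := True)"]) (unfold br, auto intro: list_emb_Cons)
    next
      assume "es \<in> set_pmf (string_at p v t)"
      then obtain st where "subseq es (filter (\<lambda>e. snd e = v) (probed t st))"
        using Probe.IH(2)[OF dist(2)] by blast
      then show ?thesis
        by (intro exI[of _ "st(e := False)"]) (unfold br, auto intro: list_emb_Cons)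
    qed
  qed
qed

text \<open>Induction on the policy, conditioning on its first probe. At a recorded probe,
  \<open>hit_Cons\<close> weights the rest by 1 - \<open>p e\<close>, exactly the chance of the
  failure branch; the success branch outputs no other edge at \<open>v\<close>, because
  \<open>e\<close> already occupies \<open>v\<close>. Any other probe averages both sides over its
  two branches in the same way.\<close>

lemma expectation_hit_string_at:
  assumes fin: "finite U" "finite V" and p: "\<forall>e\<in>U \<times> V. p e \<in> {0..1}"
    and "\<And>st. set (probed \<pi> st) \<subseteq> U \<times> V"
    and "\<And>st. distinct (probed \<pi> st)"
    and "\<And>st e e'. e \<in> outcome \<pi> st \<Longrightarrow> e' \<in> outcome \<pi> st \<Longrightarrow>
           snd e = v \<Longrightarrow> snd e' = v \<Longrightarrow> e = e'"
    and v: "snd d = v"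
  shows "measure_pmf.expectation (string_at p v \<pi>) (\<lambda>es. hit p es d) =
    measure_pmf.prob (states U V p) {st. d \<in> outcome \<pi> st}"
  using assms(4-6)
proof (induction \<pi>)
  case Stop
  then show ?case by simp
next
  case (Probe e b s t)
  let ?P = "\<lambda>\<pi>. measure_pmf.prob (states U V p) {st. d \<in> outcome \<pi> st}"
  let ?E = "\<lambda>\<pi>. measure_pmf.expectation (string_at p v \<pi>) (\<lambda>es. hit p es d)"
  \<comment> \<open>The first probe is the same in every run, so an arbitrary state
    suffices.\<close>
  have e: "e \<in> U \<times> V"
    using Probe.prems(1)[of undefined] by auto
  then have pe: "0 \<le> p e" "p e \<le> 1"
    using p by auto
  note fresh = not_probed_again[OF Probe.prems(2)]
  note br = Probe_branches[OF Probe.prems(2)]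
  have sub: "set (probed s st) \<subseteq> U \<times> V" "set (probed t st) \<subseteq> U \<times> V" for st
    using Probe.prems(1)[of "st(e := True)"] Probe.prems(1)[of "st(e := False)"]
    unfolding br by auto
  have dist: "distinct (probed s st)" "distinct (probed t st)" for st
    using Probe.prems(2)[of "st(e := True)"] Probe.prems(2)[of "st(e := False)"]
    unfolding br by auto
  have "d\<^sub>1 = d\<^sub>2"
    if "d\<^sub>1 \<in> outcome s st" "d\<^sub>2 \<in> outcome s st" "snd d\<^sub>1 = v" "snd d\<^sub>2 = v" for st d\<^sub>1 d\<^sub>2
    using Probe.prems(3)[of d\<^sub>1 "st(e := True)" d\<^sub>2] that unfolding br by blast
  then have IHs: "?E s = ?P s"
    by (rule Probe.IH(1)[OF sub(1) dist(1)])
  have "d\<^sub>1 = d\<^sub>2"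
    if "d\<^sub>1 \<in> outcome t st" "d\<^sub>2 \<in> outcome t st" "snd d\<^sub>1 = v" "snd d\<^sub>2 = v" for st d\<^sub>1 d\<^sub>2
    using Probe.prems(3)[of d\<^sub>1 "st(e := False)" d\<^sub>2] that unfolding br by blast
  then have IHt: "?E t = ?P t"
    by (rule Probe.IH(2)[OF sub(2) dist(2)])
  have split: "?P (Probe e b s t) =
      p e * measure_pmf.prob (states U V p) {st. b \<and> d = e \<or> d \<in> outcome s st} +
      (1 - p e) * ?P t"
    unfolding prob_states_resample[where e = e and p = p, OF fin e pe,
        of "\<lambda>st. d \<in> outcome (Probe e b s t) st"] br
    by (cases b) simp_all
  show ?case
  proof (cases "b \<and> snd e = v")
    case True
    show ?thesis
    proof (cases "d = e")
      case [simp]: True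
      \<comment> \<open>The edge \<open>e\<close> gets only one chance: after failing it is never
        probed again, so the total is exactly \<open>p e\<close>.\<close>
      have "d \<notin> outcome t st" for st
        using fresh(2)[of st] outcome_subset_probed[of t st] by auto
      then have "?P t = 0"
        by simp
      then show ?thesis
        unfolding split using \<open>b \<and> snd e = v\<close> by (simp add: hit_Cons)
    next
      case False
      have "d \<notin> outcome s st" for st
        using Probe.prems(3)[of e "st(e := True)" d] True False v unfolding br by auto
      then show ?thesis
        unfolding split using True False by (simp add: hit_Cons IHt)
    qed
  next
    case False
    have string: "string_at p v (Probe e b s t) =
        bind_pmf (bernoulli_pmf (p e)) (\<lambda>a. if a then string_at p v s else string_at p v t)"
      using False by auto
    have "?E (Probe e b s t) = p e * ?E s + (1 - p e) * ?E t"
      unfolding string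
      by (subst expectation_bind_pmf_finite_support[where
            S = "set_pmf (string_at p v s) \<union> set_pmf (string_at p v t)"])
         (use pe in \<open>simp_all add: finite_set_string_at mult.commute\<close>)
    \<comment> \<open>An unrecorded probe is either not committed or not at \<open>v\<close>, so it
      cannot itself output \<open>d\<close>.\<close>
    moreover have "(b \<and> d = e \<or> d \<in> outcome s st) = (d \<in> outcome s st)" for st
      using False v by auto
    ultimately show ?thesis
      by (simp only: split IHs IHt)
  qed
qed

section \<open>Weight and load of an algorithm through its output probabilities\<close>

definition output_prob ::
  "'u set \<Rightarrow> 'v set \<Rightarrow> ('u \<times> 'v \<Rightarrow> real) \<Rightarrow> ('u \<times> 'v) policy pmf \<Rightarrow> 'u \<times> 'v \<Rightarrow> real" where
  "output_prob U V p A e = measure_pmf.prob (run U V p A) {(\<pi>, st). e \<in> outcome \<pi> st}"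

lemma output_prob_eq_expectation:
  "output_prob U V p A e =
     measure_pmf.expectation A (\<lambda>\<pi>. measure_pmf.prob (states U V p) {st. e \<in> outcome \<pi> st})"
  unfolding output_prob_def run_def pair_pmf_def measure_bind_pmf map_pmf_def[symmetric]
  by (simp add: vimage_def)

text \<open>Linearity of expectation over the edges. Taking \<open>f\<close> to be \<open>w\<close>
  gives the objective; taking the indicator of the edges at \<open>u\<close> gives the load of
  \<open>u\<close>.\<close>

lemma expectation_sum_outcome:
  assumes "finite U" "finite V" "\<forall>\<pi>\<in>set_pmf A. \<forall>st. set (probed \<pi> st) \<subseteq> U \<times> V"
  shows "measure_pmf.expectation (run U V p A) (\<lambda>(\<pi>, st). \<Sum>e\<in>outcome \<pi> st. f e) =
    (\<Sum>e\<in>U \<times> V. f e * output_prob U V p A e)"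
proof -
  let ?I = "\<lambda>e. indicator {(\<pi>, st). e \<in> outcome \<pi> st} :: _ \<Rightarrow> real"
  have "(\<Sum>e\<in>outcome \<pi> st. f e) = (\<Sum>e\<in>U \<times> V. f e * ?I e (\<pi>, st))" if "\<pi> \<in> set_pmf A" for \<pi> st
  proof -
    have "outcome \<pi> st \<subseteq> U \<times> V"
      using assms(3) that outcome_subset_probed[of \<pi> st] by (meson order_trans)
    then show ?thesis
      using assms(1,2) by (intro sum.mono_neutral_cong_left) auto
  qed
  then have "measure_pmf.expectation (run U V p A) (\<lambda>(\<pi>, st). \<Sum>e\<in>outcome \<pi> st. f e) =
      measure_pmf.expectation (run U V p A) (\<lambda>x. \<Sum>e\<in>U \<times> V. f e * ?I e x)"
    by (intro integral_cong_AE) (auto simp: AE_measure_pmf_iff run_def)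
  also have "\<dots> = (\<Sum>e\<in>U \<times> V. measure_pmf.expectation (run U V p A) (\<lambda>x. f e * ?I e x))"
    by (intro Bochner_Integration.integral_sum integrable_mult_right
        measure_pmf.integrable_const_bound[where B = 1]) auto
  finally show ?thesis
    by (simp add: output_prob_def)
qed

lemma expectation_card_outcome_at:
  fixes U :: "'u set" and V :: "'v set"
  assumes "finite U" "finite V" "\<forall>\<pi>\<in>set_pmf A. \<forall>st. set (probed \<pi> st) \<subseteq> U \<times> V" "u \<in> U"
  shows "measure_pmf.expectation (run U V p A)
      (\<lambda>(\<pi>, st). real (card {e \<in> outcome \<pi> st. fst e = u})) =
    (\<Sum>v\<in>V. output_prob U V p A (u, v))"
proof -
  have "finite (outcome \<pi> st)" for \<pi> :: "('u \<times> 'v) policy" and st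
    by (rule finite_subset[OF outcome_subset_probed]) simp
  then have "real (card {e \<in> outcome \<pi> st. fst e = u}) = (\<Sum>e\<in>outcome \<pi> st. if fst e = u then 1 else 0)"
    for \<pi> :: "('u \<times> 'v) policy" and st
    by (simp add: sum.If_cases Int_def)
  then have "measure_pmf.expectation (run U V p A)
      (\<lambda>(\<pi>, st). real (card {e \<in> outcome \<pi> st. fst e = u})) =
      (\<Sum>e\<in>U \<times> V. (if fst e = u then 1 else 0) * output_prob U V p A e)"
    using expectation_sum_outcome[OF assms(1-3), where
        f = "\<lambda>e. if fst e = u then 1 else 0" and p = p] by simp
  also have "\<dots> = (\<Sum>u'\<in>U. \<Sum>v\<in>V. if u' = u then output_prob U V p A (u', v) else 0)"
    unfolding sum.cartesian_product by (intro sum.cong) auto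
  also have "\<dots> = (\<Sum>v\<in>V. output_prob U V p A (u, v))"
    using assms(1,4) by (subst sum.swap) simp
  finally show ?thesis .
qed

section \<open>Load and objective of the LP through hit probabilities\<close>

lemma LP_load_eq_sum_hit:
  assumes "\<forall>v\<in>V. finite (C v)"
  shows "(\<Sum>v\<in>V. \<Sum>es\<in>{es \<in> C v. (u, v) \<in> set es}. p (u, v) * g p (before es (u, v)) * x v es) =
    (\<Sum>v\<in>V. \<Sum>es\<in>C v. hit p es (u, v) * x v es)"
  using assms by (intro sum.cong sum.mono_neutral_cong_left) (auto simp: hit_def)

text \<open>Exchanging sums collects the coefficient of each weight. This coefficient is the LP
  counterpart of \<open>output_prob\<close>, so matching the two edge by edge matches the
  objectives.\<close>

lemma LP_value_eq_sum_hit: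
  assumes "finite U" "\<forall>v\<in>V. C v \<subseteq> strings (edges_at U v)"
  shows "LP_value V w p C x = (\<Sum>(u, v)\<in>U \<times> V. w (u, v) * (\<Sum>es\<in>C v. hit p es (u, v) * x v es))"
proof -
  have "val w p es = (\<Sum>u\<in>U. w (u, v) * hit p es (u, v))" if "v \<in> V" "es \<in> C v" for v es
  proof -
    have "val w p es = (\<Sum>e\<in>edges_at U v. w e * hit p es e)"
      using that assms by (intro val_eq_sum_hit) (auto simp: strings_def edges_at_def)
    then show ?thesis
      by (simp add: edges_at_def sum.cartesian_product')
  qed
  then have "LP_value V w p C x = (\<Sum>v\<in>V. \<Sum>es\<in>C v. \<Sum>u\<in>U. w (u, v) * (hit p es (u, v) * x v es))"
    by (simp add: LP_value_def sum_distrib_right mult.assoc)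
  also have "\<dots> = (\<Sum>v\<in>V. \<Sum>u\<in>U. w (u, v) * (\<Sum>es\<in>C v. hit p es (u, v) * x v es))"
    unfolding sum_distrib_left by (intro sum.cong refl sum.swap)
  finally show ?thesis
    by (subst (asm) sum.swap) (simp add: sum.cartesian_product)
qed

section \<open>From algorithms to LP solutions\<close>

lemma LP_solution_of_algorithm:
  assumes G: "stochastic_graph U V w p"
    and C: "\<And>v. v \<in> V \<Longrightarrow> C v \<subseteq> strings (edges_at U v)"
    and dc: "\<And>v. v \<in> V \<Longrightarrow> downward_closed (C v)"
    and A: "relaxed_probing_algorithm U V p C A"
  shows "\<exists>x. LP_feasible U V p C x \<and> LP_value V w p C x = expected_weight U V w p A"
proof -
  have fin: "finite U" "finite V" and p: "\<forall>e\<in>U \<times> V. p e \<in> {0..1}"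
    using G by (auto simp: stochastic_graph_def)
  have CV: "\<forall>v\<in>V. C v \<subseteq> strings (edges_at U v)"
    using C by blast
  have finC: "\<forall>v\<in>V. finite (C v)"
    using finite_subset[OF C] fin by (auto simp: finite_strings edges_at_def)
  have resp: "respects_probing U V C \<pi>" if "\<pi> \<in> set_pmf A" for \<pi>
    using A that by (auto simp: relaxed_probing_algorithm_def)
  then have sub: "\<forall>\<pi>\<in>set_pmf A. \<forall>st. set (probed \<pi> st) \<subseteq> U \<times> V"
    by (auto simp: respects_probing_def)
  have dist: "distinct (probed \<pi> st)" if "\<pi> \<in> set_pmf A" for \<pi> st
  proof -
    have "distinct (filter (\<lambda>d. snd d = v) (probed \<pi> st))" for v
    proof (cases "v \<in> V")
      case True
      then show ?thesis
        using resp[OF that] C[OF True] by (auto simp: respects_probing_def strings_def)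
    next
      case False
      \<comment> \<open>The constraints say nothing about vertices outside \<open>V\<close>, but all
        probes lie in \<open>U \<times> V\<close>, so such a fibre is empty.\<close>
      then have "filter (\<lambda>d. snd d = v) (probed \<pi> st) = []"
        using bspec[OF sub that] by (force simp: filter_empty_conv)
      then show ?thesis
        by simp
    qed
    then show ?thesis
      by (rule distinct_if_distinct_fibres)
  qed
  have one: "d = e"
    if "\<pi> \<in> set_pmf A" "v \<in> V" "d \<in> outcome \<pi> st" "e \<in> outcome \<pi> st" "snd d = v" "snd e = v" for \<pi> st v d e
  proof -
    have "finite {e \<in> outcome \<pi> st. snd e = v}"
      by (rule finite_subset[of _ "set (probed \<pi> st)"]) (use outcome_subset_probed[of \<pi> st] in auto)
    moreover have "card {e \<in> outcome \<pi> st. snd e = v} \<le> 1"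
      using A that by (auto simp: relaxed_probing_algorithm_def)
    ultimately have "\<forall>d\<in>{e \<in> outcome \<pi> st. snd e = v}. \<forall>e\<in>{e \<in> outcome \<pi> st. snd e = v}. d = e"
      by (simp only: card_le_Suc0_iff_eq One_nat_def)
    then show ?thesis
      using that by blast
  qed
  \<comment> \<open>Draw a policy from \<open>A\<close>, then a string from that policy; the point
    masses of this mixture form the LP solution.\<close>
  define X where "X v = bind_pmf A (string_at p v)" for v
  have supp: "set_pmf (string_at p v \<pi>) \<subseteq> C v" if \<pi>: "\<pi> \<in> set_pmf A" and v: "v \<in> V" for \<pi> v
  proof
    fix es assume "es \<in> set_pmf (string_at p v \<pi>)"
    then obtain st where "subseq es (filter (\<lambda>e. snd e = v) (probed \<pi> st))"
      using string_at_subseq_probed[of \<pi> es p v] dist[OF \<pi>] by blast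
    moreover have "filter (\<lambda>e. snd e = v) (probed \<pi> st) \<in> C v"
      using resp[OF \<pi>] v by (auto simp: respects_probing_def)
    ultimately show "es \<in> C v"
      using downward_closed_subseq[OF dc[OF v]] by blast
  qed
  \<comment> \<open>The key identity: the LP solution hits each edge with the probability that the
    algorithm outputs it. Feasibility at \<open>u\<close> and the objective value both follow from
    it.\<close>
  have load: "(\<Sum>es\<in>C v. hit p es (u, v) * pmf (X v) es) = output_prob U V p A (u, v)"
    if "v \<in> V" for u v
  proof -
    have "(\<Sum>es\<in>C v. hit p es (u, v) * pmf (X v) es) =
        measure_pmf.expectation (X v) (\<lambda>es. hit p es (u, v))"
      using supp that finC that
      by (intro integral_measure_pmf_real[symmetric]) (auto simp: X_def)
    also have "\<dots> = measure_pmf.expectation A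
        (\<lambda>\<pi>. measure_pmf.expectation (string_at p v \<pi>) (\<lambda>es. hit p es (u, v)))"
      unfolding X_def using supp that finC that
      by (intro expectation_bind_pmf_finite_support[where S = "C v"]) auto
    also have "\<dots> = output_prob U V p A (u, v)"
      unfolding output_prob_eq_expectation
    proof (intro integral_cong_AE)
      show "AE \<pi> in A. measure_pmf.expectation (string_at p v \<pi>) (\<lambda>es. hit p es (u, v)) =
          measure_pmf.prob (states U V p) {st. (u, v) \<in> outcome \<pi> st}"
        unfolding AE_measure_pmf_iff
      proof
        fix \<pi> assume "\<pi> \<in> set_pmf A"
        then show "measure_pmf.expectation (string_at p v \<pi>) (\<lambda>es. hit p es (u, v)) =
            measure_pmf.prob (states U V p) {st. (u, v) \<in> outcome \<pi> st}"
          using sub dist one[OF _ that] by (intro expectation_hit_string_at[OF fin p]) auto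
      qed
    qed auto
    finally show ?thesis .
  qed
  have "LP_feasible U V p C (\<lambda>v. pmf (X v))"
    unfolding LP_feasible_def
  proof (intro conjI ballI)
    fix u assume "u \<in> U"
    then have "(\<Sum>v\<in>V. output_prob U V p A (u, v)) \<le> 1"
      using A unfolding expectation_card_outcome_at[OF fin sub \<open>u \<in> U\<close>, symmetric]
        relaxed_probing_algorithm_def by blast
    then show "(\<Sum>v\<in>V. \<Sum>es\<in>{es \<in> C v. (u, v) \<in> set es}.
        p (u, v) * g p (before es (u, v)) * pmf (X v) es) \<le> 1"
      using LP_load_eq_sum_hit[OF finC, where x = "\<lambda>v. pmf (X v)" and u = u and p = p]
      by (simp add: load)
  next
    fix v assume "v \<in> V"
    then show "(\<Sum>es\<in>C v. pmf (X v) es) = 1"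
      using supp finC by (intro sum_pmf_eq_1) (auto simp: X_def)
  qed auto
  moreover have "LP_value V w p C (\<lambda>v. pmf (X v)) = expected_weight U V w p A"
    unfolding LP_value_eq_sum_hit[OF fin(1) CV] expected_weight_def
      expectation_sum_outcome[OF fin sub]
    by (intro sum.cong) (auto simp: load)
  ultimately show ?thesis
    by blast
qed

section \<open>From LP solutions to algorithms\<close>

primrec commit_along :: "'e list \<Rightarrow> 'e policy \<Rightarrow> 'e policy" where
  "commit_along [] k = k"
| "commit_along (e # es) k = Probe e True k (commit_along es k)"

text \<open>The piece \<open>ds\<close> ends with the first active edge of \<open>es\<close>, or is
  all of \<open>es\<close> if none is active; in both cases control passes to
  \<open>k\<close>.\<close>

lemma probed_commit_along:
  "\<exists>ds. prefix ds es \<and> probed (commit_along es k) st = ds @ probed k st"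
proof (induction es)
  case (Cons e es)
  then obtain ds where "prefix ds es" "probed (commit_along es k) st = ds @ probed k st"
    by blast
  then show ?case
    by (intro exI[of _ "if st e then [e] else e # ds"]) simp
qed simp

lemma outcome_commit_along:
  "d \<in> outcome (commit_along es k) st \<longleftrightarrow> find st es = Some d \<or> d \<in> outcome k st"
  by (induction es) auto

text \<open>Strings of different vertices use disjoint edge sets and each vertex of
  \<open>vs\<close> is treated once, so filtering at \<open>v\<close> isolates the part of
  \<open>\<sigma> v\<close> that was probed.\<close>

lemma filter_probed_commit_along:
  assumes "distinct vs" "\<And>v. v \<in> set vs \<Longrightarrow> set (\<sigma> v) \<subseteq> edges_at U v"
  shows "prefix (filter (\<lambda>e. snd e = v) (probed (foldr commit_along (map \<sigma> vs) Stop) st))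
    (if v \<in> set vs then \<sigma> v else [])"
  using assms
proof (induction vs)
  case (Cons a vs)
  let ?k = "foldr commit_along (map \<sigma> vs) Stop"
  obtain ds where ds: "prefix ds (\<sigma> a)" "probed (commit_along (\<sigma> a) ?k) st = ds @ probed ?k st"
    using probed_commit_along by blast
  have "set ds \<subseteq> edges_at U a"
    using Cons.prems(2)[of a] set_mono_prefix[OF ds(1)] by auto
  then have "filter (\<lambda>e. snd e = v) ds = (if v = a then ds else [])"
    by (auto simp: edges_at_def filter_empty_conv intro!: filter_True)
  moreover have "prefix (filter (\<lambda>e. snd e = v) (probed ?k st)) (if v \<in> set vs then \<sigma> v else [])"
    using Cons.IH Cons.prems by simp
  ultimately show ?case
    using ds Cons.prems(1) by (cases "v = a") simp_all
qed simp

lemma outcome_foldr_commit_along: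
  "d \<in> outcome (foldr commit_along ess Stop) st \<longleftrightarrow> (\<exists>es\<in>set ess. find st es = Some d)"
  by (induction ess) (auto simp: outcome_commit_along)

lemma find_Some_in_set: "find P xs = Some x \<Longrightarrow> x \<in> set xs"
  by (auto simp: find_Some_iff)

text \<open>Both sides obey the recursion of \<open>hit_Cons\<close>: since \<open>e\<close> does
  not recur in \<open>es\<close>, the search after a failure is unaffected by resampling the state
  of \<open>e\<close>.\<close>

lemma prob_find_eq_hit:
  assumes fin: "finite U" "finite V" and p: "\<forall>e\<in>U \<times> V. p e \<in> {0..1}"
    and "distinct es" "set es \<subseteq> U \<times> V"
  shows "measure_pmf.prob (states U V p) {st. find st es = Some d} = hit p es d"
  using assms(4,5)
proof (induction es)
  case (Cons e es)
  then have e: "e \<in> U \<times> V" "0 \<le> p e" "p e \<le> 1"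
    using p by auto
  have upd: "find (st(e := b)) es = find st es" for st b
    using Cons.prems by (intro find_cong) auto
  have "find (st(e := True)) (e # es) = Some e" "find (st(e := False)) (e # es) = find st es" for st
    using upd[of st False] by (simp_all del: fun_upd_apply add: fun_upd_same)
  then have "measure_pmf.prob (states U V p) {st. find st (e # es) = Some d} =
      (if e = d then p e else 0) + (1 - p e) * hit p es d"
    using prob_states_resample[where e = e and p = p, OF fin e, where Q = "\<lambda>st. find st (e # es) = Some d"] Cons
    by simp
  moreover have "hit p es e = 0"
    using Cons.prems by (simp add: hit_def)
  ultimately show ?case
    by (auto simp: hit_Cons)
qed simp

lemma algorithm_of_LP_solution:
  fixes U :: "'u set" and V :: "'v set"
  assumes G: "stochastic_graph U V w p"
    and C: "\<And>v. v \<in> V \<Longrightarrow> C v \<subseteq> strings (edges_at U v)"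
    and dc: "\<And>v. v \<in> V \<Longrightarrow> downward_closed (C v)"
    and x: "LP_feasible U V p C x"
  shows "\<exists>A. relaxed_probing_algorithm U V p C A \<and> expected_weight U V w p A = LP_value V w p C x"
proof -
  have fin: "finite U" "finite V" and p: "\<forall>e\<in>U \<times> V. p e \<in> {0..1}"
    using G by (auto simp: stochastic_graph_def)
  have CV: "\<forall>v\<in>V. C v \<subseteq> strings (edges_at U v)"
    using C by blast
  have finC: "\<forall>v\<in>V. finite (C v)"
    using finite_subset[OF C] fin by (auto simp: finite_strings edges_at_def)
  \<comment> \<open>Feasibility leaves \<open>x v\<close> unconstrained outside \<open>C v\<close>,
    so it is cut off to zero there before being read as a distribution.\<close>
  have "\<exists>X. \<forall>es. pmf X es = (if es \<in> C v then x v es else 0)" if "v \<in> V" for v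
  proof -
    let ?f = "\<lambda>es. if es \<in> C v then x v es else 0"
    have nonneg: "0 \<le> ?f es" for es
      using x that by (auto simp: LP_feasible_def)
    have "(\<integral>\<^sup>+ es. ennreal (?f es) \<partial>count_space UNIV) = (\<Sum>es\<in>C v. ennreal (?f es))"
      using finC that by (intro nn_integral_count_space') auto
    also have "\<dots> = 1"
      using x that nonneg by (subst sum_ennreal) (auto simp: LP_feasible_def)
    finally show ?thesis
      using pmf_embed_pmf[of ?f, OF nonneg] by blast
  qed
  then obtain X where X: "pmf (X v) es = (if es \<in> C v then x v es else 0)" if "v \<in> V" for v es
    by metis
  then have supp: "set_pmf (X v) \<subseteq> C v" if "v \<in> V" for v
    using that by (auto simp: set_pmf_eq split: if_splits)
  obtain vs where vs: "set vs = V" "distinct vs"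
    using finite_distinct_list[OF fin(2)] by blast
  define plan where "plan \<sigma> = foldr commit_along (map \<sigma> vs) Stop" for \<sigma> :: "'v \<Rightarrow> ('u \<times> 'v) list"
  \<comment> \<open>One independent string per vertex, with marginal \<open>X v\<close> at
    \<open>v\<close>; outside \<open>V\<close> the string defaults to the empty one.\<close>
  define S where "S = Pi_pmf V [] X"
  define A where "A = map_pmf plan S"
  have \<sigma>C: "\<sigma> v \<in> C v" if "\<sigma> \<in> set_pmf S" "v \<in> V" for \<sigma> v
    using that supp[OF that(2)] set_Pi_pmf_subset'[OF fin(2), of "[]" X]
    by (auto simp: S_def PiE_dflt_def)
  have \<sigma>E: "distinct (\<sigma> v)" "set (\<sigma> v) \<subseteq> edges_at U v" if "\<sigma> \<in> set_pmf S" "v \<in> V" for \<sigma> v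
    using \<sigma>C[OF that] C[OF that(2)] by (auto simp: strings_def)
  \<comment> \<open>An edge found in the string of a vertex is incident to that vertex, so only the
    string of \<open>snd d\<close> can output \<open>d\<close>.\<close>
  have out: "d \<in> outcome (plan \<sigma>) st \<longleftrightarrow> snd d \<in> V \<and> find st (\<sigma> (snd d)) = Some d"
    if "\<sigma> \<in> set_pmf S" for \<sigma> st d
  proof -
    have "snd d = v" if "v \<in> V" "find st (\<sigma> v) = Some d" for v
      using \<sigma>E(2)[OF \<open>\<sigma> \<in> set_pmf S\<close> that(1)] find_Some_in_set[OF that(2)] by (auto simp: edges_at_def)
    then show ?thesis
      by (auto simp: plan_def outcome_foldr_commit_along vs)
  qed
  have resp: "respects_probing U V C (plan \<sigma>)" if "\<sigma> \<in> set_pmf S" for \<sigma>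
    unfolding respects_probing_def
  proof (intro allI conjI ballI subsetI)
    fix st
    have pre: "prefix (filter (\<lambda>e. snd e = v) (probed (plan \<sigma>) st)) (if v \<in> V then \<sigma> v else [])" for v
      using filter_probed_commit_along[OF vs(2), of \<sigma> U v st] \<sigma>E(2)[OF that] by (simp add: plan_def vs(1))
    show "filter (\<lambda>e. snd e = v) (probed (plan \<sigma>) st) \<in> C v" if "v \<in> V" for v
    proof -
      have "sublist (filter (\<lambda>e. snd e = v) (probed (plan \<sigma>) st)) (\<sigma> v)"
        using pre[of v] that by (simp add: prefix_imp_sublist)
      then show ?thesis
        using \<sigma>C[OF \<open>\<sigma> \<in> set_pmf S\<close> that] dc[OF that] unfolding downward_closed_def by blast
    qed
    fix e assume "e \<in> set (probed (plan \<sigma>) st)"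
    \<comment> \<open>View \<open>e\<close> in its own fibre, a prefix of the string at
      \<open>snd e\<close>. Outside \<open>V\<close> that string is empty, so membership also forces
      \<open>snd e\<close> into \<open>V\<close>.\<close>
    then have "e \<in> set (filter (\<lambda>d. snd d = snd e) (probed (plan \<sigma>) st))"
      by simp
    then have "e \<in> set (if snd e \<in> V then \<sigma> (snd e) else [])"
      using set_mono_prefix[OF pre] by blast
    then show "e \<in> U \<times> V"
      using \<sigma>E(2)[OF that, of "snd e"] by (auto simp: edges_at_def split: if_splits)
  qed
  have sub: "\<forall>\<pi>\<in>set_pmf A. \<forall>st. set (probed \<pi> st) \<subseteq> U \<times> V"
    using resp by (auto simp: A_def respects_probing_def)
  have load: "output_prob U V p A (u, v) = (\<Sum>es\<in>C v. hit p es (u, v) * x v es)" if "v \<in> V" for u v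
  proof -
    have "output_prob U V p A (u, v) = measure_pmf.expectation S
        (\<lambda>\<sigma>. measure_pmf.prob (states U V p) {st. (u, v) \<in> outcome (plan \<sigma>) st})"
      by (simp add: output_prob_eq_expectation A_def)
    also have "\<dots> = measure_pmf.expectation S (\<lambda>\<sigma>. hit p (\<sigma> v) (u, v))"
    proof (intro integral_cong_AE)
      have "measure_pmf.prob (states U V p) {st. (u, v) \<in> outcome (plan \<sigma>) st} = hit p (\<sigma> v) (u, v)"
        if "\<sigma> \<in> set_pmf S" for \<sigma>
      proof -
        have "set (\<sigma> v) \<subseteq> U \<times> V"
          using \<sigma>E(2)[OF that \<open>v \<in> V\<close>] \<open>v \<in> V\<close> by (auto simp: edges_at_def)
        then show ?thesis
          using prob_find_eq_hit[OF fin p \<sigma>E(1)[OF that \<open>v \<in> V\<close>]] \<open>v \<in> V\<close> by (simp add: out[OF that])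
      qed
      then show "AE \<sigma> in S. measure_pmf.prob (states U V p) {st. (u, v) \<in> outcome (plan \<sigma>) st} =
          hit p (\<sigma> v) (u, v)"
        by (simp add: AE_measure_pmf_iff)
    qed auto
    also have "\<dots> = measure_pmf.expectation (map_pmf (\<lambda>\<sigma>. \<sigma> v) S) (\<lambda>es. hit p es (u, v))"
      by simp
    also have "map_pmf (\<lambda>\<sigma>. \<sigma> v) S = X v"
      using that by (simp add: S_def Pi_pmf_component[OF fin(2)])
    also have "measure_pmf.expectation (X v) (\<lambda>es. hit p es (u, v)) =
        (\<Sum>es\<in>C v. hit p es (u, v) * pmf (X v) es)"
      using supp[OF that] finC that by (intro integral_measure_pmf_real) auto
    finally show ?thesis
      using that by (simp add: X)
  qed
  have "relaxed_probing_algorithm U V p C A"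
    unfolding relaxed_probing_algorithm_def
  proof (intro conjI ballI allI)
    show "respects_probing U V C \<pi>" if "\<pi> \<in> set_pmf A" for \<pi>
      using that resp by (auto simp: A_def)
    show "card {e \<in> outcome \<pi> st. snd e = v} \<le> 1" if \<pi>: "\<pi> \<in> set_pmf A" for \<pi> st v
    proof -
      obtain \<sigma> where \<sigma>: "\<pi> = plan \<sigma>" "\<sigma> \<in> set_pmf S"
        using \<pi> by (auto simp: A_def)
      \<comment> \<open>All output at \<open>v\<close> comes from a single \<open>find\<close>,
        which returns at most one edge.\<close>
      have "{e \<in> outcome \<pi> st. snd e = v} \<subseteq> set_option (find st (\<sigma> v))"
        using \<sigma> out by auto
      then have "card {e \<in> outcome \<pi> st. snd e = v} \<le> card (set_option (find st (\<sigma> v)))"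
        by (intro card_mono) (cases "find st (\<sigma> v)", auto)
      also have "\<dots> \<le> 1"
        by (cases "find st (\<sigma> v)") auto
      finally show ?thesis .
    qed
    fix u assume "u \<in> U"
    then show "measure_pmf.expectation (run U V p A)
        (\<lambda>(\<pi>, st). real (card {e \<in> outcome \<pi> st. fst e = u})) \<le> 1"
      using x unfolding expectation_card_outcome_at[OF fin sub \<open>u \<in> U\<close>]
        LP_feasible_def LP_load_eq_sum_hit[of V C, OF finC]
      by (simp add: load)
  qed
  moreover have "expected_weight U V w p A = LP_value V w p C x"
    unfolding LP_value_eq_sum_hit[OF fin(1) CV] expected_weight_def
      expectation_sum_outcome[OF fin sub]
    by (intro sum.cong) (auto simp: load)
  ultimately show ?thesis
    by blast
qed

section \<open>Equality of the two optima\<close>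

theorem theorem11:
  fixes U :: "'u set" and V :: "'v set"
    and w p :: "'u \<times> 'v \<Rightarrow> real"
    and C :: "'v \<Rightarrow> ('u \<times> 'v) list set"
  assumes "stochastic_graph U V w p"
    and "\<And>v. v \<in> V \<Longrightarrow> C v \<subseteq> strings (edges_at U v)"
    and "\<And>v. v \<in> V \<Longrightarrow> downward_closed (C v)"
  shows "OPT_rel U V w p C = LPOPT U V w p C"
  unfolding OPT_rel_def LPOPT_def
proof (rule antisym)
  \<comment> \<open>Every value attained in one problem is attained in the other, so the suprema are
    compared without knowing whether they are attained.\<close>
  show "(SUP A\<in>{A. relaxed_probing_algorithm U V p C A}. ereal (expected_weight U V w p A))
      \<le> (SUP x\<in>{x. LP_feasible U V p C x}. ereal (LP_value V w p C x))"
    using LP_solution_of_algorithm[OF assms] by (intro SUP_mono) force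
  show "(SUP x\<in>{x. LP_feasible U V p C x}. ereal (LP_value V w p C x))
      \<le> (SUP A\<in>{A. relaxed_probing_algorithm U V p C A}. ereal (expected_weight U V w p A))"
    using algorithm_of_LP_solution[OF assms] by (intro SUP_mono) force
qed

end
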